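(* Let $1-1/\sqrt{3}\le r\le 1/2$. Then the shape optimization problem $$\mathcal A(r):=\min\big\{|\Omega| : \Omega\subset\mathbb R^2 \text{ a convex body of constant width } 1,\ \rho(\Omega)=r\big\}$$ has a solution, i.e. the minimum is attained.
   Context: A convex body is a compact convex set with nonempty interior. It has constant width $1$ if, for every direction $\nu\in\mathbb S^1$, the minimal distance between two parallel lines orthogonal to $\nu$ enclosing it is $1$. The inradius $\rho(\Omega)$ is the largest $r$ for which an open disk of radius $r$ is contained in $\Omega$. $|\Omega|$ denotes the area. *)

theory Defs
  imports "HOL-Analysis.Analysis"
begin

definition convex_body :: "(real^2) set \<Rightarrow> bool" where
  "convex_body K \<longleftrightarrow> compact K \<and> convex K \<and> interior K \<noteq> {}"

text \<open>For a unit vector \<open>\<nu>\<close>, the lines orthogonal to \<open>\<nu>\<close> are the sets \<open>{x. \<nu> \<bullet> x = a}\<close>, and the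
  distance between those at levels \<open>a \<le> b\<close> is \<open>b - a\<close>. For compact nonempty \<open>K\<close> the infimum is a
  minimum.\<close>

definition width :: "(real^2) set \<Rightarrow> real^2 \<Rightarrow> real" where
  "width K \<nu> = Inf {b - a | a b. a \<le> b \<and> K \<subseteq> {x. a \<le> \<nu> \<bullet> x \<and> \<nu> \<bullet> x \<le> b}}"

definition constant_width :: "real \<Rightarrow> (real^2) set \<Rightarrow> bool" where
  "constant_width w K \<longleftrightarrow> (\<forall>\<nu>. norm \<nu> = 1 \<longrightarrow> width K \<nu> = w)"

text \<open>For compact \<open>K\<close> with nonempty interior the supremum is a maximum.\<close>

definition inradius :: "(real^2) set \<Rightarrow> real" where
  "inradius K = Sup {r. 0 < r \<and> (\<exists>c. ball c r \<subseteq> K)}"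

definition area :: "(real^2) set \<Rightarrow> real" where
  "area K = measure lebesgue K"

definition admissible :: "real \<Rightarrow> (real^2) set set" where
  "admissible r = {K. convex_body K \<and> constant_width 1 K \<and> inradius K = r}"

end

theory Submission
  imports Defs "HOL-Complex_Analysis.Great_Picard"
begin

text \<open>Minimizing sequence: after translation all bodies lie in the unit disk, so a subsequence
  converges in the Hausdorff sense (Arzela--Ascoli for the distance functions). Width and inradius
  pass to the limit, and area is lower semicontinuous because every interior point of the limit
  eventually belongs to all bodies of the sequence. The class is nonempty because the Minkowski sum
  of a Reuleaux triangle of side \<open>a\<close> and a disk of radius \<open>(1 - a) / 2\<close> has constant width \<open>1\<close> and
  inradius \<open>a * (1 - 1 / sqrt 3) + (1 - a) / 2\<close>.\<close>

section \<open>Width and inradius\<close>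

text \<open>A linear functional attains its extrema on a compact set, so the infimum is the gap
  between the two supporting lines. The form by differences \<open>x - y\<close> is translation
  invariant and survives limits.\<close>

lemma width_eq_iff:
  assumes "compact K" "K \<noteq> {}"
  shows "width K \<nu> = w \<longleftrightarrow>
    (\<forall>x\<in>K. \<forall>y\<in>K. \<nu> \<bullet> (x - y) \<le> w) \<and> (\<exists>x\<in>K. \<exists>y\<in>K. \<nu> \<bullet> (x - y) = w)"
proof -
  have cont: "continuous_on K (\<lambda>x. \<nu> \<bullet> x)"
    by (intro continuous_intros)
  obtain p where p: "p \<in> K" "\<And>x. x \<in> K \<Longrightarrow> \<nu> \<bullet> p \<le> \<nu> \<bullet> x"
    using continuous_attains_inf[OF assms cont] by blast
  obtain q where q: "q \<in> K" "\<And>x. x \<in> K \<Longrightarrow> \<nu> \<bullet> x \<le> \<nu> \<bullet> q"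
    using continuous_attains_sup[OF assms cont] by blast
  have "width K \<nu> = \<nu> \<bullet> (q - p)"
    unfolding width_def
  proof (rule cInf_eq_minimum)
    show "\<nu> \<bullet> (q - p) \<in> {b - a |a b. a \<le> b \<and> K \<subseteq> {x. a \<le> \<nu> \<bullet> x \<and> \<nu> \<bullet> x \<le> b}}"
      unfolding mem_Collect_eq using p q
      by (intro exI[of _ "\<nu> \<bullet> q"] exI[of _ "\<nu> \<bullet> p"]) (auto simp: inner_diff_right)
    show "\<nu> \<bullet> (q - p) \<le> d"
      if "d \<in> {b - a |a b. a \<le> b \<and> K \<subseteq> {x. a \<le> \<nu> \<bullet> x \<and> \<nu> \<bullet> x \<le> b}}" for d
    proof -
      from that obtain a b where "d = b - a" "K \<subseteq> {x. a \<le> \<nu> \<bullet> x \<and> \<nu> \<bullet> x \<le> b}"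
        by blast
      moreover from this p(1) q(1) have "a \<le> \<nu> \<bullet> p" "\<nu> \<bullet> q \<le> b"
        by blast+
      ultimately show ?thesis
        by (simp add: inner_diff_right)
    qed
  qed
  moreover have "\<nu> \<bullet> (x - y) \<le> \<nu> \<bullet> (q - p)" if "x \<in> K" "y \<in> K" for x y
    using p(2)[OF that(2)] q(2)[OF that(1)] by (simp add: inner_diff_right)
  ultimately show ?thesis
    using p(1) q(1) by (metis order_antisym)
qed

lemma bdd_above_inball_radii:
  fixes K :: "(real^2) set"
  assumes "bounded K"
  shows "bdd_above {r. 0 < r \<and> (\<exists>c. ball c r \<subseteq> K)}"
proof (rule bdd_aboveI)
  fix r assume "r \<in> {r. 0 < r \<and> (\<exists>c. ball c r \<subseteq> K)}"
  then obtain c where "0 < r" "ball c r \<subseteq> K"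
    by blast
  then show "r \<le> diameter K / 2"
    using diameter_subset[OF \<open>ball c r \<subseteq> K\<close> assms] by simp
qed

lemma inradius_upper:
  assumes "bounded K" "0 < r" "ball c r \<subseteq> K"
  shows "r \<le> inradius K"
  unfolding inradius_def using assms by (intro cSup_upper bdd_above_inball_radii) auto

lemma inradius_approx:
  assumes "bounded K" "interior K \<noteq> {}" "t < inradius K"
  obtains c r where "t < r" "0 < r" "ball c r \<subseteq> K"
proof -
  obtain x e where "0 < e" "ball x e \<subseteq> K"
    using assms(2) by (auto simp: mem_interior)
  then have "{r. 0 < r \<and> (\<exists>c. ball c r \<subseteq> K)} \<noteq> {}"
    by blast
  then show ?thesis
    using assms(3) that less_cSup_iff[OF _ bdd_above_inball_radii[OF assms(1)]]
    unfolding inradius_def by blast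
qed

lemma inradius_eqI:
  assumes "0 < r" "ball c r \<subseteq> K"
    and "\<And>c' r'. 0 < r' \<Longrightarrow> ball c' r' \<subseteq> K \<Longrightarrow> r' \<le> r"
  shows "inradius K = r"
  unfolding inradius_def using assms by (intro cSup_eq_maximum) auto

text \<open>Permits moving a point of each body to the origin, which later confines a minimizing
  sequence to one disk.\<close>

lemma admissible_translation:
  assumes "K \<in> admissible r"
  shows "(+) v ` K \<in> admissible r"
proof -
  have K: "compact K" "convex K" "interior K \<noteq> {}" "constant_width 1 K" "inradius K = r"
    using assms by (auto simp: admissible_def convex_body_def)
  have ne: "K \<noteq> {}"
    using K(3) by auto
  have "constant_width 1 ((+) v ` K)"
    using K(4) ne K(1) compact_translation[OF K(1), of v]
    by (simp add: constant_width_def width_eq_iff)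
  moreover have "ball c s \<subseteq> (+) v ` K \<longleftrightarrow> ball (c - v) s \<subseteq> K" for c s
  proof -
    have "ball c s = (+) v ` ball (c - v) s"
      by (simp add: ball_translation[symmetric])
    then show ?thesis
      by (simp only: inj_image_subset_iff[OF inj_on_add])
  qed
  then have "(\<exists>c. ball c s \<subseteq> (+) v ` K) \<longleftrightarrow> (\<exists>c. ball c s \<subseteq> K)" for s
    by (metis add_diff_cancel_right')
  then have "inradius ((+) v ` K) = r"
    using K(5) unfolding inradius_def by simp
  ultimately show ?thesis
    using K compact_translation[OF K(1), of v]
    by (simp add: admissible_def convex_body_def convex_translation interior_translation)
qed

text \<open>The width in the direction \<open>sgn (x - y)\<close> already controls the distance
  between \<open>x\<close> and \<open>y\<close>.\<close>

lemma constant_width_norm_diff_le: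
  assumes "compact K" "constant_width w K" "x \<in> K" "y \<in> K" "0 \<le> w"
  shows "norm (x - y) \<le> w"
proof (cases "x = y")
  case False
  then have "norm (sgn (x - y)) = 1"
    by (simp add: norm_sgn)
  then have "sgn (x - y) \<bullet> (x - y) \<le> w"
    using assms width_eq_iff[of K] unfolding constant_width_def by blast
  then show ?thesis
    using False by (simp add: sgn_div_norm dot_square_norm power2_eq_square mult.assoc[symmetric])
qed (use assms in simp)

section \<open>Hausdorff limits\<close>

text \<open>Hausdorff convergence in two halves: \<open>inner\<close> brings \<open>K n\<close>
  uniformly close to the points of \<open>L\<close>, and \<open>outer\<close> puts limits of points
  chosen along any subsequence into \<open>L\<close>. For sets inside a common compact set the two
  together are Hausdorff convergence.\<close>

locale set_limit =
  fixes K :: "nat \<Rightarrow> 'a::euclidean_space set" and L :: "'a set"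
  assumes compact_K: "compact (K n)" and nonempty: "K n \<noteq> {}" and compact_L: "compact L"
    and inner: "0 < e \<Longrightarrow> \<forall>\<^sub>F n in sequentially. \<forall>x\<in>L. infdist x (K n) < e"
    and outer: "strict_mono \<tau> \<Longrightarrow> (\<And>n. x n \<in> K (\<tau> n)) \<Longrightarrow> x \<longlonglongrightarrow> l \<Longrightarrow> l \<in> L"

lemma Blaschke_selection:
  fixes K :: "nat \<Rightarrow> 'a::euclidean_space set"
  assumes S: "compact S" and K: "\<And>n. compact (K n)" "\<And>n. K n \<noteq> {}" "\<And>n. K n \<subseteq> S"
  obtains \<sigma> L where "strict_mono \<sigma>" "set_limit (\<lambda>n. K (\<sigma> n)) L"
proof -
  have lip: "\<bar>infdist x (K n) - infdist y (K n)\<bar> \<le> norm (x - y)" for n x y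
    using infdist_triangle_abs[of x "K n" y] by (simp add: dist_norm)
  have bound: "norm (infdist x (K n)) \<le> diameter S" if "x \<in> S" for n x
  proof -
    obtain y where y: "y \<in> K n"
      using K(2) by blast
    then have "infdist x (K n) \<le> dist x y"
      by (rule infdist_le)
    also have "\<dots> \<le> diameter S"
      using diameter_bounded_bound[OF compact_imp_bounded[OF S] that] y K(3) by blast
    finally show ?thesis
      by (simp add: infdist_nonneg)
  qed
  obtain g \<sigma> where g: "continuous_on S g" and \<sigma>: "strict_mono (\<sigma> :: nat \<Rightarrow> nat)"
    and unif: "\<And>e. 0 < e \<Longrightarrow> \<exists>N. \<forall>n x. n \<ge> N \<and> x \<in> S \<longrightarrow> norm (infdist x (K (\<sigma> n)) - g x) < e"
  proof (rule Arzela_Ascoli[OF S, of "\<lambda>n x. infdist x (K n)" "diameter S"])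
    \<comment> \<open>Equicontinuity: distance functions are 1-Lipschitz, so \<open>d = e\<close>
      serves for all \<open>n\<close>.\<close>
    show "\<exists>d>0. \<forall>n y. y \<in> S \<and> norm (x - y) < d \<longrightarrow> norm (infdist x (K n) - infdist y (K n)) < e"
      if "0 < e" for x e
      using lip that by (intro exI[of _ e]) (auto intro: le_less_trans)
  qed (use bound in auto)
  \<comment> \<open>A closed set is the zero set of its distance function; the limit set is
    therefore taken as the zero set of the uniform limit \<open>g\<close>.\<close>
  define L where "L = {x \<in> S. g x = 0}"
  have "set_limit (\<lambda>n. K (\<sigma> n)) L"
  proof
    have "closed L"
      unfolding L_def using continuous_closed_preimage_constant[OF g compact_imp_closed[OF S]] .
    moreover have "L = S \<inter> L"
      by (auto simp: L_def)
    ultimately show "compact L"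
      using S by (metis compact_Int_closed)
    show "\<forall>\<^sub>F n in sequentially. \<forall>x\<in>L. infdist x (K (\<sigma> n)) < e" if "0 < e" for e
      using unif[OF that] infdist_nonneg
      by (fastforce simp: eventually_sequentially L_def)
    show "l \<in> L"
      if \<tau>: "strict_mono \<tau>" and x: "\<And>n. x n \<in> K (\<sigma> (\<tau> n))" and lim: "x \<longlonglongrightarrow> l" for \<tau> x l
    proof -
      have l: "l \<in> S"
        using closed_sequentially[OF compact_imp_closed[OF S] _ lim] x K(3) by blast
      \<comment> \<open>The distances from the fixed point \<open>l\<close> tend to
        \<open>g l\<close>; along \<open>\<tau>\<close> they are also at most
        \<open>dist l (x n)\<close>, which tends to 0.\<close>
      have "(\<lambda>n. infdist l (K (\<sigma> n))) \<longlonglongrightarrow> g l"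
        using unif l unfolding LIMSEQ_def dist_norm by meson
      then have "(\<lambda>n. infdist l (K (\<sigma> (\<tau> n)))) \<longlonglongrightarrow> g l"
        using LIMSEQ_subseq_LIMSEQ[OF _ \<tau>] by (fastforce simp: o_def)
      moreover have "(\<lambda>n. infdist l (K (\<sigma> (\<tau> n)))) \<longlonglongrightarrow> 0"
      proof (rule tendsto_sandwich[OF _ _ tendsto_const])
        show "(\<lambda>n. dist l (x n)) \<longlonglongrightarrow> 0"
          using tendsto_dist[OF tendsto_const[of l] lim] by simp
      qed (use infdist_le[OF x] infdist_nonneg in \<open>auto intro!: always_eventually\<close>)
      ultimately have "g l = 0"
        by (rule LIMSEQ_unique)
      with l show ?thesis
        by (simp add: L_def)
    qed
  qed (use K in auto)
  with \<sigma> that show ?thesis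
    by blast
qed

section \<open>Convexity, inner balls and measure under set limits\<close>

context set_limit
begin

text \<open>Nearest points of the compact sets \<open>K n\<close> to \<open>x\<close> converge to
  \<open>x\<close> by \<open>inner\<close>.\<close>

lemma approximating_sequence:
  assumes "x \<in> L"
  obtains y where "\<And>n. y n \<in> K n" "y \<longlonglongrightarrow> x"
proof -
  have "\<exists>y\<in>K n. infdist x (K n) = dist x y" for n
    using infdist_attains_inf[OF compact_imp_closed[OF compact_K] nonempty] by metis
  then obtain y where y: "\<And>n. y n \<in> K n" "\<And>n. infdist x (K n) = dist x (y n)"
    by metis
  have "y \<longlonglongrightarrow> x"
  proof (rule tendstoI)
    show "\<forall>\<^sub>F n in sequentially. dist (y n) x < e" if "0 < e" for e
      using inner[OF that] assms y by (auto elim!: eventually_mono simp: dist_commute)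
  qed
  with y that show ?thesis
    by blast
qed

lemma limit_point:
  assumes "\<And>n. x n \<in> K n" "x \<longlonglongrightarrow> l"
  shows "l \<in> L"
  using outer[of id x l] assms by (simp add: strict_mono_id)

lemma convex_limit:
  assumes "\<And>n. convex (K n)"
  shows "convex L"
proof (rule convexI)
  fix x y :: 'a and u v :: real
  assume xy: "x \<in> L" "y \<in> L" and uv: "0 \<le> u" "0 \<le> v" "u + v = 1"
  obtain p where p: "\<And>n. p n \<in> K n" "p \<longlonglongrightarrow> x"
    using approximating_sequence[OF xy(1)] by blast
  obtain q where q: "\<And>n. q n \<in> K n" "q \<longlonglongrightarrow> y"
    using approximating_sequence[OF xy(2)] by blast
  show "u *\<^sub>R x + v *\<^sub>R y \<in> L"
  proof (rule limit_point)
    show "(\<lambda>n. u *\<^sub>R p n + v *\<^sub>R q n) \<longlonglongrightarrow> u *\<^sub>R x + v *\<^sub>R y"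
      by (intro tendsto_intros p q)
    show "u *\<^sub>R p n + v *\<^sub>R q n \<in> K n" for n
      using convexD[OF assms p(1) q(1) uv] .
  qed
qed

text \<open>If \<open>z \<notin> K n\<close> lies well inside the limit, moving away from \<open>K n\<close> across a separating line
  produces a point of the limit whose distance to \<open>K n\<close> is not small.\<close>

lemma eventually_ball_subset:
  assumes conv: "\<And>n. convex (K n)" and sub: "ball c r \<subseteq> L" and "s < r"
  shows "\<forall>\<^sub>F n in sequentially. ball c s \<subseteq> K n"
proof -
  \<comment> \<open>The gap between the radii is the room for a shift by \<open>e\<close> that stays
    inside \<open>ball c r\<close>.\<close>
  define e where "e = r - s"
  have "0 < e"
    using assms(3) by (simp add: e_def)
  show ?thesis
  proof (rule eventually_mono[OF inner[OF \<open>0 < e\<close>]])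
    fix n assume close: "\<forall>x\<in>L. infdist x (K n) < e"
    show "ball c s \<subseteq> K n"
    proof (rule ccontr)
      assume "\<not> ball c s \<subseteq> K n"
      then obtain z where z: "dist c z < s" "z \<notin> K n"
        by (metis mem_ball subsetI)
      obtain a b where ab: "a \<bullet> z < b" "\<And>x. x \<in> K n \<Longrightarrow> b < a \<bullet> x"
        using separating_hyperplane_closed_point[OF conv compact_imp_closed[OF compact_K] z(2)]
        by blast
      have "a \<noteq> 0"
        using ab nonempty[of n] by force
      define \<nu> where "\<nu> = sgn a"
      have \<nu>: "norm \<nu> = 1" "a \<bullet> \<nu> = norm a"
        using \<open>a \<noteq> 0\<close>
        by (auto simp: \<nu>_def norm_sgn sgn_div_norm dot_square_norm power2_eq_square)
      \<comment> \<open>Shifted by \<open>e\<close> away from the half-space containing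
        \<open>K n\<close>, the point still lies in \<open>L\<close>, yet its distance to every
        point of \<open>K n\<close> exceeds \<open>e\<close>.\<close>
      define y where "y = z - e *\<^sub>R \<nu>"
      have "dist c y \<le> dist c z + dist z y"
        by (rule dist_triangle)
      also have "dist z y = e"
        using \<nu>(1) \<open>0 < e\<close> by (simp add: y_def dist_norm)
      finally have "y \<in> L"
        using z(1) sub by (auto simp: e_def)
      then have "infdist y (K n) < e"
        using close by blast
      then obtain x where x: "x \<in> K n" "dist y x < e"
        using infdist_attains_inf[OF compact_imp_closed[OF compact_K] nonempty] by metis
      have "norm a * e < a \<bullet> (x - y)"
        using ab(1) ab(2)[OF x(1)] \<nu>(2) by (simp add: y_def inner_diff_right mult.commute)
      also have "\<dots> \<le> norm a * norm (x - y)"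
        by (rule norm_cauchy_schwarz)
      also have "\<dots> \<le> norm a * e"
        using x(2) by (intro mult_left_mono) (auto simp: dist_norm norm_minus_commute)
      finally show False
        by simp
    qed
  qed
qed

text \<open>Interior points of \<open>L\<close> lie in all late \<open>K n\<close>, hence in an
  increasing union of sets of measure at most \<open>B\<close>; the frontier of the convex set
  \<open>L\<close> is null. This is lower semicontinuity of the area.\<close>

lemma measure_limit_le:
  assumes conv: "\<And>n. convex (K n)" and le: "\<forall>\<^sub>F n in sequentially. measure lebesgue (K n) \<le> B"
  shows "measure lebesgue L \<le> B"
proof -
  \<comment> \<open>The common part of a tail of the sequence; the intersection with
    \<open>L\<close> keeps the union over \<open>m\<close> of finite measure.\<close>
  define D where "D m = L \<inter> (\<Inter>n\<in>{m..}. K n)" for m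
  have D: "D m \<in> lmeasurable" for m
    unfolding D_def using compact_L compact_K
    by (intro lmeasurable_compact compact_Int_closed closed_INT) (auto intro: compact_imp_closed)
  have "incseq D"
    by (fastforce simp: incseq_def D_def)
  have D_le: "measure lebesgue (D m) \<le> B" for m
  proof -
    obtain N where N: "\<And>n. N \<le> n \<Longrightarrow> measure lebesgue (K n) \<le> B"
      using le by (auto simp: eventually_sequentially)
    \<comment> \<open>The index is at least \<open>m\<close>, so the set contains
      \<open>D m\<close>, and at least \<open>N\<close>, so the bound \<open>B\<close>
      applies.\<close>
    have "measure lebesgue (D m) \<le> measure lebesgue (K (max m N))"
      using D compact_K by (intro measure_mono_fmeasurable) (auto simp: D_def lmeasurable_compact
        intro: fmeasurableD)
    also have "\<dots> \<le> B"
      using N by simp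
    finally show ?thesis .
  qed
  have DL: "(\<Union>m. D m) \<in> lmeasurable"
    and D_lim: "(\<lambda>m. measure lebesgue (D m)) \<longlonglongrightarrow> measure lebesgue (\<Union>m. D m)"
  proof -
    have "(\<Union>m. D m) \<subseteq> L"
      by (auto simp: D_def)
    moreover have "(\<Union>m. D m) \<in> sets lebesgue"
      using D by (auto intro: fmeasurableD)
    ultimately show DL: "(\<Union>m. D m) \<in> lmeasurable"
      using fmeasurableI2[OF lmeasurable_compact[OF compact_L]] by blast
    show "(\<lambda>m. measure lebesgue (D m)) \<longlonglongrightarrow> measure lebesgue (\<Union>m. D m)"
      using D \<open>incseq D\<close> fmeasurableD2[OF DL]
      by (intro Lim_measure_incseq) (auto intro: fmeasurableD)
  qed
  have int: "interior L \<subseteq> (\<Union>m. D m)"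
  proof
    fix x assume x: "x \<in> interior L"
    then obtain e where e: "0 < e" "ball x e \<subseteq> L"
      by (auto simp: mem_interior)
    then have "\<forall>\<^sub>F n in sequentially. ball x (e / 2) \<subseteq> K n"
      by (intro eventually_ball_subset[OF conv]) auto
    then obtain m where m: "\<And>n. m \<le> n \<Longrightarrow> ball x (e / 2) \<subseteq> K n"
      by (auto simp: eventually_sequentially)
    have "x \<in> D m"
      using x interior_subset m e(1) by (force simp: D_def)
    then show "x \<in> (\<Union>m. D m)"
      by blast
  qed
  have "measure lebesgue L = measure lebesgue (interior L)"
  proof (rule measure_negligible_symdiff[symmetric])
    show "L \<in> lmeasurable"
      using compact_L by (rule lmeasurable_compact)
    show "negligible (L - interior L \<union> (interior L - L))"
      using interior_subset[of L] closure_subset[of L]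
      by (intro negligible_subset[OF negligible_convex_frontier[OF convex_limit[OF conv]]])
        (auto simp: frontier_def)
  qed
  also have "\<dots> \<le> measure lebesgue (\<Union>m. D m)"
    using int DL by (intro measure_mono_fmeasurable) auto
  also have "\<dots> \<le> B"
    using D_lim D_le by (intro LIMSEQ_le_const2) auto
  finally show ?thesis .
qed

end

section \<open>Closedness of the admissible class\<close>

text \<open>Nearly maximal inscribed balls have a convergent subsequence of centres, which gives a
  ball of radius \<open>r\<close> in \<open>L\<close>; a larger one would already fit into some
  \<open>K n\<close>. Widths pass through approximating sequences (upper bound) and limits of
  extremal pairs (attainment).\<close>

lemma admissible_limit:
  assumes lim: "set_limit K L" and K: "\<And>n. K n \<in> admissible r" and "0 < r"
    and S: "compact S" "\<And>n. K n \<subseteq> S"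
  shows "L \<in> admissible r"
proof -
  interpret set_limit K L
    by (rule lim)
  have conv: "convex (K n)" and inr: "inradius (K n) = r" and int: "interior (K n) \<noteq> {}" for n
    using K by (auto simp: admissible_def convex_body_def)
  have bdd: "bounded (K n)" for n
    using compact_K compact_imp_bounded by blast
  have "\<exists>c s. r - 1 / Suc n < s \<and> 0 < s \<and> ball c s \<subseteq> K n" for n
  proof (rule inradius_approx[OF bdd[of n] int[of n], of "r - 1 / Suc n"])
    show "r - 1 / Suc n < inradius (K n)"
      using inr[of n] by simp
  qed blast
  then obtain c s where cs: "\<And>n. r - 1 / Suc n < s n" "\<And>n. 0 < s n" "\<And>n. ball (c n) (s n) \<subseteq> K n"
    by metis
  have "c n \<in> S" for n
    using cs(2,3)[of n] S(2)[of n] by (meson centre_in_ball subsetD)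
  then obtain c0 \<tau> where \<tau>: "strict_mono \<tau>" and c0: "(c \<circ> \<tau>) \<longlonglongrightarrow> c0"
    using S(1) unfolding compact_def by metis
  have ball: "ball c0 r \<subseteq> L"
  proof
    fix x assume x: "x \<in> ball c0 r"
    have "(\<lambda>n. r - 1 / Suc n) \<longlonglongrightarrow> r - 0"
      using LIMSEQ_inverse_real_of_nat by (intro tendsto_intros) (simp add: inverse_eq_divide)
    from LIMSEQ_subseq_LIMSEQ[OF this \<tau>] have "(\<lambda>n. r - 1 / Suc (\<tau> n)) \<longlonglongrightarrow> r - 0"
      by (simp add: o_def)
    moreover have "(\<lambda>n. dist (c (\<tau> n)) x) \<longlonglongrightarrow> dist c0 x"
      using tendsto_dist[OF c0 tendsto_const[of x]] by (simp add: o_def)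
    ultimately have "(\<lambda>n. r - 1 / Suc (\<tau> n) - dist (c (\<tau> n)) x) \<longlonglongrightarrow> r - 0 - dist c0 x"
      by (rule tendsto_diff)
    moreover have "0 < r - 0 - dist c0 x"
      using x by simp
    ultimately have "\<forall>\<^sub>F n in sequentially. 0 < r - 1 / Suc (\<tau> n) - dist (c (\<tau> n)) x"
      by (rule order_tendstoD)
    then obtain N where N: "\<And>n. N \<le> n \<Longrightarrow> 0 < r - 1 / Suc (\<tau> n) - dist (c (\<tau> n)) x"
      by (auto simp: eventually_sequentially)
    \<comment> \<open>\<open>outer\<close> asks for membership at every index, so the subsequence is
      shifted past \<open>N\<close> and applied to the constant sequence \<open>x\<close>.\<close>
    have "x \<in> K (\<tau> (n + N))" for n
    proof -
      have "x \<in> ball (c (\<tau> (n + N))) (s (\<tau> (n + N)))"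
        using N[of "n + N"] cs(1)[of "\<tau> (n + N)"] by simp
      then show ?thesis
        using cs(3) by blast
    qed
    moreover have "strict_mono (\<lambda>n. \<tau> (n + N))"
      using \<tau> by (simp add: strict_mono_def)
    ultimately show "x \<in> L"
      using outer[of "\<lambda>n. \<tau> (n + N)" "\<lambda>_. x" x] by simp
  qed
  have neL: "L \<noteq> {}"
    using ball \<open>0 < r\<close> by auto
  have "inradius L = r"
  proof (rule inradius_eqI[OF \<open>0 < r\<close> ball])
    fix c' r' assume "0 < r'" and sub: "ball c' r' \<subseteq> L"
    show "r' \<le> r"
    proof (rule ccontr)
      assume "\<not> r' \<le> r"
      \<comment> \<open>Balls of \<open>L\<close> pass to \<open>K n\<close> only with a smaller
        radius; \<open>t\<close> loses some radius and still exceeds \<open>r\<close>.\<close>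
      then obtain t where t: "r < t" "t < r'"
        using dense by (metis not_le)
      then obtain n where "ball c' t \<subseteq> K n"
        using eventually_happens[OF eventually_ball_subset[OF conv sub t(2)]] by auto
      then show False
        using inradius_upper[OF bdd[of n], of t c'] inr[of n] t(1) \<open>0 < r\<close> by simp
    qed
  qed
  moreover have "width L \<nu> = 1" if \<nu>: "norm \<nu> = 1" for \<nu>
  proof -
    have w: "\<forall>x\<in>K n. \<forall>y\<in>K n. \<nu> \<bullet> (x - y) \<le> 1" "\<exists>x\<in>K n. \<exists>y\<in>K n. \<nu> \<bullet> (x - y) = 1" for n
      using K[of n] \<nu> width_eq_iff[OF compact_K nonempty, of n \<nu> 1]
      by (auto simp: admissible_def constant_width_def)
    have "\<nu> \<bullet> (x - y) \<le> 1" if xy: "x \<in> L" "y \<in> L" for x y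
    proof -
      obtain p where p: "\<And>n. p n \<in> K n" "p \<longlonglongrightarrow> x"
        using approximating_sequence[OF xy(1)] by blast
      obtain q where q: "\<And>n. q n \<in> K n" "q \<longlonglongrightarrow> y"
        using approximating_sequence[OF xy(2)] by blast
      have "(\<lambda>n. \<nu> \<bullet> (p n - q n)) \<longlonglongrightarrow> \<nu> \<bullet> (x - y)"
        by (intro tendsto_intros p q)
      then show ?thesis
        using w(1) p(1) q(1) by (intro LIMSEQ_le_const2) blast+
    qed
    moreover have "\<exists>x\<in>L. \<exists>y\<in>L. \<nu> \<bullet> (x - y) = 1"
    proof -
      obtain a b where ab: "\<And>n. a n \<in> K n" "\<And>n. b n \<in> K n" "\<And>n. \<nu> \<bullet> (a n - b n) = 1"
        using w(2) by metis
      \<comment> \<open>Compactness of the product yields one subsequence along which both end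
        points converge.\<close>
      have "\<And>n. (a n, b n) \<in> S \<times> S"
        using ab S(2) by blast
      then obtain l \<rho> where \<rho>: "strict_mono \<rho>" and l: "((\<lambda>n. (a n, b n)) \<circ> \<rho>) \<longlonglongrightarrow> l"
        using seq_compactE[OF compact_imp_seq_compact[OF compact_Times[OF S(1) S(1)]]] by metis
      have a: "(\<lambda>n. a (\<rho> n)) \<longlonglongrightarrow> fst l" and b: "(\<lambda>n. b (\<rho> n)) \<longlonglongrightarrow> snd l"
        using tendsto_fst[OF l] tendsto_snd[OF l] by (simp_all add: o_def)
      have "fst l \<in> L" "snd l \<in> L"
        using outer[OF \<rho> _ a] outer[OF \<rho> _ b] ab by auto
      moreover have "(\<lambda>n. \<nu> \<bullet> (a (\<rho> n) - b (\<rho> n))) \<longlonglongrightarrow> \<nu> \<bullet> (fst l - snd l)"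
        by (intro tendsto_intros a b)
      then have "\<nu> \<bullet> (fst l - snd l) = 1"
        using ab(3) by (simp add: LIMSEQ_const_iff)
      ultimately show ?thesis
        by blast
    qed
    ultimately show ?thesis
      using width_eq_iff[OF compact_L neL] by blast
  qed
  moreover have "interior L \<noteq> {}"
    using ball \<open>0 < r\<close> interior_maximal[OF ball open_ball] by auto
  ultimately show ?thesis
    using compact_L convex_limit[OF conv]
    by (auto simp: admissible_def convex_body_def constant_width_def)
qed

section \<open>Rounded Reuleaux triangles\<close>

text \<open>The vertices \<open>p\<close>, \<open>q\<close>, \<open>-p-q\<close> of an equilateral triangle of side \<open>1\<close> centred at the origin
  form a tight frame; the Reuleaux triangle below has side \<open>a\<close>.\<close>

definition reuleaux :: "real^2 \<Rightarrow> real^2 \<Rightarrow> real \<Rightarrow> (real^2) set" where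
  "reuleaux p q a = cball (a *\<^sub>R p) a \<inter> cball (a *\<^sub>R q) a \<inter> cball (a *\<^sub>R (- p - q)) a"

text \<open>Circumradius \<open>1 / sqrt 3\<close> and angles of 120 degrees between the vertices.
  The quantified conjunct is the frame expansion, which recovers \<open>v\<close> from its inner
  products with the three vertices.\<close>

definition triangle_frame :: "real^2 \<Rightarrow> real^2 \<Rightarrow> bool" where
  "triangle_frame p q \<longleftrightarrow> p \<bullet> p = 1 / 3 \<and> q \<bullet> q = 1 / 3 \<and> p \<bullet> q = - 1 / 6 \<and>
    (\<forall>v. v = (2 * (v \<bullet> p)) *\<^sub>R p + (2 * (v \<bullet> q)) *\<^sub>R q + (2 * (v \<bullet> (- p - q))) *\<^sub>R (- p - q))"

lemma triangle_frame_exists: "\<exists>p q. triangle_frame p q"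
proof (intro exI)
  show "triangle_frame (vector [1 / sqrt 3, 0]) (vector [- 1 / (2 * sqrt 3), 1 / 2])"
  proof -
    have [simp]: "sqrt 3 * (sqrt 3 * x) = 3 * x" for x
      by (simp add: mult.assoc[symmetric])
    show ?thesis
      by (auto simp: triangle_frame_def inner_vec_def sum_2 vec_eq_iff forall_2 field_simps)
  qed
qed

text \<open>The third vertex belonging to \<open>q\<close> and \<open>- p - q\<close> is
  \<open>p\<close>, so cyclic symmetry reduces the support computation to one vertex.\<close>

lemma triangle_frame_rotate:
  assumes "triangle_frame p q"
  shows "triangle_frame q (- p - q)"
  using assms unfolding triangle_frame_def
  by (auto simp: inner_diff inner_commute algebra_simps)

lemma reuleaux_rotate: "reuleaux q (- p - q) a = reuleaux p q a"
  by (auto simp: reuleaux_def)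

lemma norm_diff_scaleR_sq:
  fixes y w :: "'a::real_inner"
  shows "(norm (y - t *\<^sub>R w))\<^sup>2 = (norm y)\<^sup>2 - 2 * t * (y \<bullet> w) + t\<^sup>2 * (w \<bullet> w)"
  unfolding power2_norm_eq_inner
  by (simp add: inner_simps inner_commute power2_eq_square algebra_simps)

text \<open>The hypotheses place \<open>\<nu>\<close> in the angle of the triangle at the third vertex \<open>- p - q\<close>, so that
  direction \<open>\<nu>\<close> meets the arc centred at that vertex.\<close>

lemma reuleaux_support_cone:
  assumes fr: "triangle_frame p q" and a: "0 \<le> a" and \<nu>: "norm \<nu> = 1"
    and pos: "0 \<le> \<nu> \<bullet> p" "0 \<le> \<nu> \<bullet> q"
  shows "\<exists>v\<in>reuleaux p q a. v + a *\<^sub>R \<nu> \<in> reuleaux p q a \<and>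
    (\<forall>x\<in>reuleaux p q a. \<nu> \<bullet> v \<le> \<nu> \<bullet> x \<and> \<nu> \<bullet> x \<le> \<nu> \<bullet> v + a)"
proof -
  define o' where "o' = - p - q"
  define b c where "b = \<nu> \<bullet> p" and "c = \<nu> \<bullet> q"
  have pq: "p \<bullet> p = 1 / 3" "q \<bullet> q = 1 / 3" "p \<bullet> q = - 1 / 6" "q \<bullet> p = - 1 / 6"
    using fr by (auto simp: triangle_frame_def inner_commute)
  \<comment> \<open>The coefficients of the frame expansion sum to 0, so it regroups into the edge
    vectors at \<open>o'\<close>, with non-negative weights.\<close>
  have \<nu>_eq: "\<nu> = (2 * b) *\<^sub>R (p - o') + (2 * c) *\<^sub>R (q - o')"
  proof -
    have "\<nu> = (2 * b) *\<^sub>R p + (2 * c) *\<^sub>R q + (2 * (- b - c)) *\<^sub>R o'"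
      using fr unfolding triangle_frame_def b_def c_def o'_def
      by (metis inner_diff_right inner_minus_right)
    then show ?thesis
      by (simp add: algebra_simps)
  qed
  have unit: "(p - o') \<bullet> (p - o') = 1" "(q - o') \<bullet> (q - o') = 1"
    unfolding o'_def inner_diff_left inner_diff_right inner_minus_left inner_minus_right pq
    by simp_all
  have heights: "\<nu> \<bullet> (p - o') = 2 * b + c" "\<nu> \<bullet> (q - o') = b + 2 * c"
    unfolding o'_def inner_diff_right inner_minus_right b_def c_def
    by simp_all
  have sq: "4 * (b * b + c * c + b * c) = 1"
  proof -
    have "\<nu> \<bullet> \<nu> = 1"
      using \<nu> by (simp add: dot_square_norm)
    moreover have "\<nu> \<bullet> \<nu> = 2 * b * (\<nu> \<bullet> (p - o')) + 2 * c * (\<nu> \<bullet> (q - o'))"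
      by (subst (2) \<nu>_eq) (simp add: inner_add_right)
    ultimately show ?thesis
      using heights by (simp add: algebra_simps)
  qed
  \<comment> \<open>The edge vectors are unit, so by \<open>heights\<close> this says that \<nu>
    makes an angle of at most 60 degrees with each edge at \<open>o'\<close>.\<close>
  have half: "1 / 2 \<le> 2 * b + c" "1 / 2 \<le> b + 2 * c"
  proof -
    have "0 \<le> b * b" "0 \<le> c * c" "0 \<le> b * c"
      using pos by (simp_all add: b_def c_def)
    then have "(1 / 2)\<^sup>2 \<le> (2 * b + c)\<^sup>2" "(1 / 2)\<^sup>2 \<le> (b + 2 * c)\<^sup>2"
      unfolding power2_eq_square using sq by argo+
    then show "1 / 2 \<le> 2 * b + c" "1 / 2 \<le> b + 2 * c"
      using pos by (auto simp: b_def c_def intro: power2_le_imp_le)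
  qed
  \<comment> \<open>For unit vectors \<nu> and \<open>u - o'\<close> the squared distance of
    \<open>o' + \<nu>\<close> from \<open>u\<close> is
    \<open>2 - 2 * (\<nu> \<bullet> (u - o'))\<close>, at most 1 by \<open>half\<close>.\<close>
  have edge: "norm (o' - u) = 1" "norm (o' + \<nu> - u) \<le> 1" if u: "u = p \<or> u = q" for u
  proof -
    have un: "(u - o') \<bullet> (u - o') = 1" "1 / 2 \<le> \<nu> \<bullet> (u - o')"
      using u unit half heights by auto
    then show "norm (o' - u) = 1"
      by (metis norm_eq_1 norm_minus_commute)
    have "(o' + \<nu> - u) \<bullet> (o' + \<nu> - u) = (u - o') \<bullet> (u - o') + \<nu> \<bullet> \<nu> - 2 * (\<nu> \<bullet> (u - o'))"
      by (simp add: inner_simps inner_commute)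
    then have "(norm (o' + \<nu> - u))\<^sup>2 \<le> 1\<^sup>2"
      using un \<nu> by (simp add: power2_norm_eq_inner[symmetric])
    then show "norm (o' + \<nu> - u) \<le> 1"
      by (rule power2_le_imp_le) simp
  qed
  define v where "v = a *\<^sub>R o'"
  have dists: "norm (a *\<^sub>R u - v) \<le> a" "norm (a *\<^sub>R u - (v + a *\<^sub>R \<nu>)) \<le> a" if "u = p \<or> u = q" for u
  proof -
    have "a *\<^sub>R u - v = - (a *\<^sub>R (o' - u))" "a *\<^sub>R u - (v + a *\<^sub>R \<nu>) = - (a *\<^sub>R (o' + \<nu> - u))"
      by (simp_all add: v_def algebra_simps)
    then show "norm (a *\<^sub>R u - v) \<le> a" "norm (a *\<^sub>R u - (v + a *\<^sub>R \<nu>)) \<le> a"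
      using edge[OF that] a by (simp_all add: mult_left_le)
  qed
  have "v \<in> reuleaux p q a" "v + a *\<^sub>R \<nu> \<in> reuleaux p q a"
    using dists a \<nu> by (auto simp: reuleaux_def dist_norm o'_def[symmetric] v_def[symmetric])
  moreover have "\<nu> \<bullet> v \<le> \<nu> \<bullet> x \<and> \<nu> \<bullet> x \<le> \<nu> \<bullet> v + a" if x: "x \<in> reuleaux p q a" for x
  proof
    have xv: "norm (x - v) \<le> a" and xu: "norm (x - a *\<^sub>R p) \<le> a" "norm (x - a *\<^sub>R q) \<le> a"
      using x by (auto simp: reuleaux_def dist_norm norm_minus_commute o'_def v_def)
    have "\<nu> \<bullet> (x - v) \<le> norm \<nu> * norm (x - v)"
      by (rule norm_cauchy_schwarz)
    with xv \<nu> show "\<nu> \<bullet> x \<le> \<nu> \<bullet> v + a"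
      by (simp add: inner_diff_right)
    \<comment> \<open>The circle of radius \<open>a\<close> about \<open>a *\<^sub>R u\<close>
      passes through \<open>v\<close>, and its disk lies on one side of the tangent there. Combining
      both tangents with the weights of \<open>\<nu>_eq\<close> makes \<open>v\<close> lowest in
      direction \<nu>.\<close>
    have tangent: "0 \<le> (x - v) \<bullet> (u - o')" if u: "u = p \<or> u = q" for u
    proof (cases "a = 0")
      case True
      with xv show ?thesis
        by simp
    next
      case False
      have "x - a *\<^sub>R u = (x - v) - a *\<^sub>R (u - o')"
        by (simp add: v_def algebra_simps)
      then have "(norm (x - a *\<^sub>R u))\<^sup>2
          = (norm (x - v))\<^sup>2 - 2 * a * ((x - v) \<bullet> (u - o')) + a\<^sup>2 * ((u - o') \<bullet> (u - o'))"
        by (simp only: norm_diff_scaleR_sq)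
      moreover have "(norm (x - a *\<^sub>R u))\<^sup>2 \<le> a\<^sup>2"
        using u xu by (auto intro: power_mono)
      moreover have "(u - o') \<bullet> (u - o') = 1"
        using u unit by auto
      ultimately have "0 \<le> 2 * a * ((x - v) \<bullet> (u - o'))"
        by (smt (verit) mult_cancel_left1 zero_le_power2)
      then show ?thesis
        using a False by (simp add: zero_le_mult_iff)
    qed
    have "(x - v) \<bullet> \<nu> = 2 * b * ((x - v) \<bullet> (p - o')) + 2 * c * ((x - v) \<bullet> (q - o'))"
      by (subst \<nu>_eq) (simp add: inner_add_right)
    also have "0 \<le> \<dots>"
      using tangent pos by (simp add: b_def c_def)
    finally show "\<nu> \<bullet> v \<le> \<nu> \<bullet> x"
      by (simp add: inner_commute inner_diff_right)
  qed
  ultimately show ?thesis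
    by blast
qed

text \<open>Up to sign and rotation every direction falls under
  \<open>reuleaux_support_cone\<close>; for \<open>- \<nu>\<close> the lower and upper support
  points change places.\<close>

lemma reuleaux_support:
  assumes fr: "triangle_frame p q" and a: "0 \<le> a" and \<nu>: "norm \<nu> = 1"
  obtains u w where "u \<in> reuleaux p q a" "w \<in> reuleaux p q a" "w = u + a *\<^sub>R \<nu>"
    "\<And>x. x \<in> reuleaux p q a \<Longrightarrow> \<nu> \<bullet> u \<le> \<nu> \<bullet> x \<and> \<nu> \<bullet> x \<le> \<nu> \<bullet> w"
proof -
  let ?R = "reuleaux p q a"
  let ?P = "\<lambda>\<nu>. \<exists>v\<in>?R. v + a *\<^sub>R \<nu> \<in> ?R \<and> (\<forall>x\<in>?R. \<nu> \<bullet> v \<le> \<nu> \<bullet> x \<and> \<nu> \<bullet> x \<le> \<nu> \<bullet> v + a)"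
  have fr2: "triangle_frame q (- p - q)" and fr3: "triangle_frame (- p - q) p"
    using triangle_frame_rotate[OF fr] triangle_frame_rotate[OF triangle_frame_rotate[OF fr]]
    by simp_all
  have R3: "reuleaux (- p - q) p a = ?R"
    using reuleaux_rotate[of "- p - q" q a] reuleaux_rotate[of p q a]
    by (auto simp: reuleaux_def)
  have cone: "?P n" if n: "norm n = 1" and s: "0 \<le> n \<bullet> p \<and> 0 \<le> n \<bullet> q \<or> 0 \<le> n \<bullet> q \<and> 0 \<le> n \<bullet> (- p - q)
      \<or> 0 \<le> n \<bullet> (- p - q) \<and> 0 \<le> n \<bullet> p" for n
    using s reuleaux_support_cone[OF fr a n] reuleaux_support_cone[OF fr2 a n]
      reuleaux_support_cone[OF fr3 a n] unfolding reuleaux_rotate R3 by blast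
  \<comment> \<open>The inner products of \<nu> with the three vertices sum to 0, so two of them are
    both non-negative or both non-positive.\<close>
  have "?P \<nu> \<or> ?P (- \<nu>)"
    using cone[of \<nu>] cone[of "- \<nu>"] \<nu> unfolding norm_minus_cancel inner_minus_left
    by (smt (verit))
  then show ?thesis
  proof
    assume "?P \<nu>"
    then obtain v where "v \<in> ?R" "v + a *\<^sub>R \<nu> \<in> ?R"
      "\<And>x. x \<in> ?R \<Longrightarrow> \<nu> \<bullet> v \<le> \<nu> \<bullet> x \<and> \<nu> \<bullet> x \<le> \<nu> \<bullet> v + a"
      by blast
    then show ?thesis
      using that[of v "v + a *\<^sub>R \<nu>"] \<nu> by (simp add: inner_add_right dot_square_norm)
  next
    assume "?P (- \<nu>)"
    then obtain v where "v \<in> ?R" "v - a *\<^sub>R \<nu> \<in> ?R"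
      "\<And>x. x \<in> ?R \<Longrightarrow> \<nu> \<bullet> x \<le> \<nu> \<bullet> v \<and> \<nu> \<bullet> v \<le> \<nu> \<bullet> x + a"
      by force
    then show ?thesis
      using that[of "v - a *\<^sub>R \<nu>" v] \<nu>
      by (simp add: inner_diff_right dot_square_norm algebra_simps)
  qed
qed

section \<open>Width and inradius of the rounded triangle\<close>

lemma rounded_reuleaux_admissible:
  assumes "0 \<le> a" "a \<le> 1"
  shows "admissible (a * (1 - 1 / sqrt 3) + (1 - a) / 2) \<noteq> {}"
proof -
  obtain p q where fr: "triangle_frame p q"
    using triangle_frame_exists by blast
  define R where "R = reuleaux p q a"
  define s where "s = (1 - a) / 2"
  define K where "K = {x + y | x y. x \<in> R \<and> y \<in> cball 0 s}"
  define \<rho> where "\<rho> = a * (1 - 1 / sqrt 3) + (1 - a) / 2"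
  have s: "0 \<le> s" "a + 2 * s = 1"
    using assms by (auto simp: s_def field_simps)
  have \<rho>: "0 < \<rho>" "\<rho> = a - a / sqrt 3 + s"
  proof -
    show "\<rho> = a - a / sqrt 3 + s"
      by (simp add: \<rho>_def s_def algebra_simps)
    have "0 < a * (1 - 1 / sqrt 3) \<or> 0 < s"
      using assms s by (cases "a = 0") (auto simp: s_def)
    moreover have "0 \<le> a * (1 - 1 / sqrt 3)"
      using assms by simp
    ultimately show "0 < \<rho>"
      using s(1) unfolding \<rho>_def s_def by linarith
  qed
  have pq: "p \<bullet> p = 1 / 3" "q \<bullet> q = 1 / 3" "p \<bullet> q = - 1 / 6" "q \<bullet> p = - 1 / 6"
    using fr by (auto simp: triangle_frame_def inner_commute)
  define V where "V = {p, q, - p - q}"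
  have R_eq: "R = (\<Inter>u\<in>V. cball (a *\<^sub>R u) a)"
    by (auto simp: R_def reuleaux_def V_def)
  have normV: "norm u = 1 / sqrt 3" if "u \<in> V" for u
  proof -
    have "u \<bullet> u = 1 / 3"
      using that pq by (auto simp: V_def inner_simps)
    then show ?thesis
      by (simp only: norm_eq_sqrt_inner real_sqrt_divide real_sqrt_one)
  qed
  have "compact R" "convex R"
    unfolding R_def reuleaux_def by (intro compact_Int convex_Int compact_cball convex_cball)+
  moreover have "K = (\<Union>x\<in>R. \<Union>y\<in>cball 0 s. {x + y})"
    unfolding K_def by blast
  ultimately have "compact K" "convex K"
    using compact_sums[OF _ compact_cball, of R 0 s] convex_sums[OF _ convex_cball, of R 0 s]
    by (simp_all only: K_def)
  have ball: "ball 0 \<rho> \<subseteq> K"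
  proof
    fix x :: "real^2" assume x: "x \<in> ball 0 \<rho>"
    \<comment> \<open>The disk of radius \<open>d\<close> about the origin lies in \<open>R\<close>.
      As \<open>\<rho> = d + s\<close>, splitting \<open>x\<close> in the proportion
      \<open>d : s\<close> exhibits it as a point of the Minkowski sum.\<close>
    define d where "d = a - a / sqrt 3"
    have "d = a * (1 - 1 / sqrt 3)"
      by (simp add: d_def right_diff_distrib)
    then have "0 \<le> d"
      using assms(1) by simp
    have R: "y \<in> R" if "norm y \<le> d" for y
      unfolding R_eq
    proof
      fix u assume "u \<in> V"
      have "norm (a *\<^sub>R u - y) \<le> norm (a *\<^sub>R u) + norm y"
        by (rule norm_triangle_ineq4)
      also have "\<dots> \<le> a"
        using normV[OF \<open>u \<in> V\<close>] that assms by (simp add: d_def)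
      finally show "y \<in> cball (a *\<^sub>R u) a"
        by (simp add: dist_norm)
    qed
    have nx: "norm x \<le> d + s"
      using x by (simp add: \<rho> d_def)
    have scaled: "norm ((e / \<rho>) *\<^sub>R x) \<le> e" if "0 \<le> e" for e
      using mult_left_mono[OF nx that] that \<rho> by (simp add: d_def[symmetric] pos_divide_le_eq)
    have "(d / \<rho>) *\<^sub>R x \<in> R"
      using scaled[OF \<open>0 \<le> d\<close>] by (rule R)
    moreover have "(s / \<rho>) *\<^sub>R x \<in> cball 0 s"
      using scaled[OF s(1)] by simp
    moreover have "x = (d / \<rho>) *\<^sub>R x + (s / \<rho>) *\<^sub>R x"
      using \<rho> by (simp add: d_def[symmetric] scaleR_add_left[symmetric] add_divide_distrib[symmetric])
    ultimately show "x \<in> K"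
      unfolding K_def by blast
  qed
  have "interior K \<noteq> {}"
    using interior_maximal[OF ball open_ball] \<rho>(1) by auto
  \<comment> \<open>The enlarged disks bound the inradius from above: a ball inside one of them
    loses radius in proportion to the distance of its centre from
    \<open>a *\<^sub>R u\<close>.\<close>
  have K_cball: "K \<subseteq> cball (a *\<^sub>R u) (a + s)" if "u \<in> V" for u
  proof
    fix z assume "z \<in> K"
    then obtain x y where z: "z = x + y" "x \<in> R" "norm y \<le> s"
      by (auto simp: K_def)
    then have "norm (a *\<^sub>R u - x) \<le> a"
      using that by (auto simp: R_eq dist_norm)
    moreover have "norm (a *\<^sub>R u - z) \<le> norm (a *\<^sub>R u - x) + norm y"
      using norm_triangle_ineq4[of "a *\<^sub>R u - x" y] by (simp add: z algebra_simps)
    ultimately show "z \<in> cball (a *\<^sub>R u) (a + s)"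
      using z(3) by (simp add: dist_norm)
  qed
  have "inradius K = \<rho>"
  proof (rule inradius_eqI[OF \<rho>(1) ball])
    fix c t assume t: "0 < t" "ball c t \<subseteq> K"
    text \<open>Some vertex has distance at least \<open>a / sqrt 3\<close> from \<open>c\<close>, since the vertices sum to \<open>0\<close>.\<close>
    have "c \<bullet> p + c \<bullet> q + c \<bullet> (- p - q) = 0"
      by (simp add: inner_simps)
    then obtain u where u: "u \<in> V" "c \<bullet> u \<le> 0"
      unfolding V_def by (smt (verit) insertCI)
    have "(a / sqrt 3)\<^sup>2 \<le> (norm (c - a *\<^sub>R u))\<^sup>2"
    proof -
      have "(norm (c - a *\<^sub>R u))\<^sup>2 = (norm c)\<^sup>2 - 2 * a * (c \<bullet> u) + a\<^sup>2 * (norm u)\<^sup>2"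
        by (simp only: norm_diff_scaleR_sq power2_norm_eq_inner[of u])
      moreover have "a\<^sup>2 * (norm u)\<^sup>2 = (a / sqrt 3)\<^sup>2"
        by (simp add: normV[OF u(1)] power_divide)
      moreover have "2 * a * (c \<bullet> u) \<le> 0"
        using u(2) assms(1) by (simp add: mult_nonneg_nonpos)
      ultimately show ?thesis
        by (smt (verit) zero_le_power2)
    qed
    then have "a / sqrt 3 \<le> norm (c - a *\<^sub>R u)"
      by (rule power2_le_imp_le) simp
    moreover have "dist c (a *\<^sub>R u) + t \<le> a + s"
      using order_trans[OF t(2) K_cball[OF u(1)]] t(1) by (simp add: ball_subset_cball_iff)
    ultimately show "t \<le> \<rho>"
      by (simp add: \<rho> dist_norm)
  qed
  moreover have "width K \<nu> = 1" if \<nu>: "norm \<nu> = 1" for \<nu>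
  proof -
    obtain u w where uw: "u \<in> R" "w \<in> R" "w = u + a *\<^sub>R \<nu>"
      "\<And>x. x \<in> R \<Longrightarrow> \<nu> \<bullet> u \<le> \<nu> \<bullet> x \<and> \<nu> \<bullet> x \<le> \<nu> \<bullet> w"
      using reuleaux_support[OF fr assms(1) \<nu>] unfolding R_def by metis
    have \<nu>\<nu>: "\<nu> \<bullet> \<nu> = 1"
      using \<nu> by (simp add: dot_square_norm)
    \<comment> \<open>Adding the disk moves both supporting lines of \<open>R\<close> outwards by
      \<open>s\<close>, for a total width of \<open>a + 2 * s = 1\<close>.\<close>
    have slab: "\<nu> \<bullet> u - s \<le> \<nu> \<bullet> z \<and> \<nu> \<bullet> z \<le> \<nu> \<bullet> w + s" if "z \<in> K" for z
    proof -
      obtain x y where z: "z = x + y" "x \<in> R" "norm y \<le> s"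
        using \<open>z \<in> K\<close> by (auto simp: K_def)
      have "\<bar>\<nu> \<bullet> y\<bar> \<le> s"
        using Cauchy_Schwarz_ineq2[of \<nu> y] \<nu> z(3) by simp
      then show ?thesis
        using uw(4)[OF z(2)] unfolding z(1) inner_add_right by linarith
    qed
    have "\<nu> \<bullet> (x - y) \<le> 1" if "x \<in> K" "y \<in> K" for x y
      using slab[OF that(1)] slab[OF that(2)] s(2) \<nu>\<nu> by (simp add: uw(3) inner_simps)
    moreover have "s *\<^sub>R \<nu> \<in> cball 0 s" "(- s) *\<^sub>R \<nu> \<in> cball 0 s"
      using s(1) \<nu> by simp_all
    then have "w + s *\<^sub>R \<nu> \<in> K" "u + (- s) *\<^sub>R \<nu> \<in> K"
      unfolding K_def using uw(1,2) by blast+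
    moreover have "\<nu> \<bullet> ((w + s *\<^sub>R \<nu>) - (u + (- s) *\<^sub>R \<nu>)) = 1"
      unfolding uw(3) inner_diff_right inner_add_right inner_scaleR_right \<nu>\<nu> using s(2) by simp
    moreover have "K \<noteq> {}"
      using \<open>interior K \<noteq> {}\<close> by auto
    ultimately show ?thesis
      using width_eq_iff[OF \<open>compact K\<close>] by blast
  qed
  ultimately have "K \<in> admissible \<rho>"
    using \<open>compact K\<close> \<open>convex K\<close> \<open>interior K \<noteq> {}\<close>
    by (simp add: admissible_def convex_body_def constant_width_def)
  then show ?thesis
    unfolding \<rho>_def by blast
qed

section \<open>Existence of a minimizer\<close>

theorem proposition1p1:
  fixes r :: real
  assumes "1 - 1 / sqrt 3 \<le> r" and "r \<le> 1 / 2"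
  shows "\<exists>\<Omega> \<in> admissible r. \<forall>\<Omega>' \<in> admissible r. area \<Omega> \<le> area \<Omega>'"
proof -
  have r0: "0 < r"
  proof -
    have "1 / sqrt 3 < 1"
      by simp
    with assms(1) show ?thesis
      by linarith
  qed
  have sqrt3: "1 / 2 < 1 / sqrt 3"
    by (simp add: real_less_lsqrt)
  \<comment> \<open>Solves \<open>a * (1 - 1 / sqrt 3) + (1 - a) / 2 = r\<close>;
    \<open>a = 0\<close> is the disk with \<open>r = 1 / 2\<close>, and \<open>a = 1\<close> the
    Reuleaux triangle with \<open>r = 1 - 1 / sqrt 3\<close>.\<close>
  define a where "a = (1 / 2 - r) / (1 / sqrt 3 - 1 / 2)"
  have "0 \<le> a" "a \<le> 1"
    using assms sqrt3 by (auto simp: a_def)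
  moreover have "a * (1 / sqrt 3 - 1 / 2) = 1 / 2 - r"
    using sqrt3 by (simp add: a_def)
  then have "a * (1 - 1 / sqrt 3) + (1 - a) / 2 = r"
    by argo
  ultimately have ne: "admissible r \<noteq> {}"
    using rounded_reuleaux_admissible by metis
  define m where "m = Inf (area ` admissible r)"
  have bdd: "bdd_below (area ` admissible r)"
    by (rule bdd_belowI[of _ 0]) (auto simp: area_def)
  \<comment> \<open>A minimizing sequence, translated so that each body contains the origin; with
    diameter at most 1 it then lies in the unit disk.\<close>
  have "\<exists>K\<in>admissible r. 0 \<in> K \<and> area K < m + 1 / Suc n" for n
  proof -
    have "m < m + 1 / Suc n"
      by simp
    then obtain K where K: "K \<in> admissible r" "area K < m + 1 / Suc n"
      using cInf_less_iff[OF _ bdd] ne unfolding m_def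
      by (metis (no_types, lifting) imageE image_is_empty)
    obtain x where "x \<in> K"
      using K(1) interior_subset by (fastforce simp: admissible_def convex_body_def)
    then have "0 \<in> (+) (- x) ` K"
      by force
    moreover have "area ((+) (- x) ` K) = area K"
      unfolding area_def by (rule measure_translation)
    ultimately show ?thesis
      using K admissible_translation by metis
  qed
  then obtain K where K: "\<And>n. K n \<in> admissible r" "\<And>n. 0 \<in> K n" "\<And>n. area (K n) < m + 1 / Suc n"
    by metis
  have comp: "compact (K n)" "convex (K n)" "constant_width 1 (K n)" for n
    using K(1)[of n] by (auto simp: admissible_def convex_body_def)
  have ne_K: "K n \<noteq> {}" for n
    using K(2) by blast
  have sub: "K n \<subseteq> cball 0 1" for n
    using constant_width_norm_diff_le[OF comp(1,3) _ K(2)] by fastforce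
  obtain \<sigma> L where \<sigma>: "strict_mono \<sigma>" and lim: "set_limit (\<lambda>n. K (\<sigma> n)) L"
    by (rule Blaschke_selection[OF compact_cball comp(1) ne_K sub])
  interpret set_limit "\<lambda>n. K (\<sigma> n)" L
    by (rule lim)
  have "L \<in> admissible r"
    using admissible_limit[OF lim K(1) r0 compact_cball sub] .
  moreover have "area L \<le> m"
  proof (rule field_le_epsilon)
    fix e :: real assume "0 < e"
    then obtain N where N: "inverse (real (Suc N)) < e"
      using reals_Archimedean by blast
    have "\<forall>\<^sub>F n in sequentially. measure lebesgue (K (\<sigma> n)) \<le> m + e"
      unfolding eventually_sequentially
    proof (intro exI allI impI)
      fix n assume "N \<le> n"
      \<comment> \<open>A strictly increasing index map satisfies \<open>n \<le> \<sigma> n\<close>,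
        so the error \<open>1 / Suc (\<sigma> n)\<close> is below \<open>e\<close> from
        \<open>N\<close> on.\<close>
      then have "N \<le> \<sigma> n"
        using seq_suble[OF \<sigma>, of n] by linarith
      then have "1 / real (Suc (\<sigma> n)) \<le> inverse (real (Suc N))"
        by (simp add: inverse_eq_divide frac_le)
      then show "measure lebesgue (K (\<sigma> n)) \<le> m + e"
        using K(3)[of "\<sigma> n"] N by (simp add: area_def)
    qed
    then show "area L \<le> m + e"
      unfolding area_def using measure_limit_le comp(2) by blast
  qed
  moreover have "m \<le> area \<Omega>'" if "\<Omega>' \<in> admissible r" for \<Omega>'
    unfolding m_def using bdd that by (intro cInf_lower) auto
  ultimately show ?thesis
    by force
qed

end
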